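(* Let $G$ be a finite group of the smallest order such that $G\notin\mathcal{F}$ (that is, $G\notin\mathcal{F}$ and every finite group of order less than $|G|$ belongs to $\mathcal{F}$). Then the following hold: (i) $G$ is a nonabelian simple group; (ii) if $a\in\mathcal{D}(G)$, then neither $a$ nor $|G|/a$ divides the order of any proper subgroup of $G$.
   Context: A finite group $G$ is said to be factorized into subsets $A,B\subseteq G$, written $G=AB$, if every $g\in G$ can be uniquely represented as $g=xy$ with $x\in A$ and $y\in B$ (equivalently, $G=\{xy : x\in A, y\in B\}$ and $|G|=|A||B|$). $\mathcal{F}$ denotes the class of all finite groups $G$ such that for every factorization $|G|=ab$ of the order of $G$ into positive integers $a,b$ there is a factorization $G=AB$ into subsets with $|A|=a$ and $|B|=b$. For a finite group $G$ of order $n$, $\mathcal{D}(G)$ denotes the set of positive divisors $a$ of $n$ such that $G$ cannot be factorized as $G=AB$ with $|A|=a$ and $|B|=n/a$. Thus $G\in\mathcal{F}$ if and only if $\mathcal{D}(G)=\varnothing$. *)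

theory Defs
  imports "HOL-Algebra.Algebra" "HOL-Algebra.SimpleGroups"
begin

definition group_factorization ::
  "('a, 'b) monoid_scheme \<Rightarrow> 'a set \<Rightarrow> 'a set \<Rightarrow> bool" where
  "group_factorization G A B \<longleftrightarrow>
     A \<subseteq> carrier G \<and> B \<subseteq> carrier G \<and>
     (\<forall>g \<in> carrier G. \<exists>!p. p \<in> A \<times> B \<and> g = fst p \<otimes>\<^bsub>G\<^esub> snd p)"

definition class_F :: "('a, 'b) monoid_scheme \<Rightarrow> bool" where
  "class_F G \<longleftrightarrow>
     group G \<and> finite (carrier G) \<and>
     (\<forall>a b. a > 0 \<longrightarrow> b > 0 \<longrightarrow> order G = a * b \<longrightarrow>
       (\<exists>A B. group_factorization G A B \<and> card A = a \<and> card B = b))"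

definition set_D :: "('a, 'b) monoid_scheme \<Rightarrow> nat set" where
  "set_D G = {a. a > 0 \<and> a dvd order G \<and>
     \<not> (\<exists>A B. group_factorization G A B \<and> card A = a \<and> card B = order G div a)}"

(* HOL cannot quantify over groups of all carrier types inside a formula, so the
   minimality hypothesis ranges over groups with carrier in nat. The lemma
   class_F_if_nat_groups shows that this covers the finite groups on every type. *)
definition smaller_groups_in_F :: "nat \<Rightarrow> bool" where
  "smaller_groups_in_F n \<longleftrightarrow>
     (\<forall>H :: nat monoid. group H \<longrightarrow> finite (carrier H) \<longrightarrow> order H < n \<longrightarrow> class_F H)"

definition minimal_non_F :: "('a, 'b) monoid_scheme \<Rightarrow> bool" where
  "minimal_non_F G \<longleftrightarrow>
     group G \<and> finite (carrier G) \<and> \<not> class_F G \<and> smaller_groups_in_F (order G)"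

lemma class_F_iff_set_D_empty:
  assumes "group G" "finite (carrier G)"
  shows "class_F G \<longleftrightarrow> set_D G = {}"
proof -
  have pos: "order G > 0"
    using assms by (metis group.is_monoid monoid.order_gt_0_iff_finite)
  show ?thesis
  proof
    assume F: "class_F G"
    show "set_D G = {}"
    proof (rule equals0I)
      fix a assume a: "a \<in> set_D G"
      then have "order G = a * (order G div a)" "a > 0"
        by (auto simp: set_D_def)
      moreover from this pos have "order G div a > 0"
        by (metis mult_is_0 neq0_conv)
      ultimately show False
        using F a unfolding class_F_def set_D_def by blast
    qed
  next
    assume D: "set_D G = {}"
    have "\<exists>A B. group_factorization G A B \<and> card A = a \<and> card B = b"
      if "a > 0" "order G = a * b" for a b
    proof -
      have "a \<notin> set_D G" using D by simp
      moreover have "order G div a = b" "a dvd order G" using that by auto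
      ultimately show ?thesis using that by (auto simp: set_D_def)
    qed
    then show "class_F G" using assms by (auto simp: class_F_def)
  qed
qed

lemma group_factorization_iso:
  assumes grp: "group H" and f: "f \<in> iso H G" and fac: "group_factorization H A B"
  shows "group_factorization G (f ` A) (f ` B)"
    and "card (f ` A) = card A" and "card (f ` B) = card B"
proof -
  have hom: "\<And>x y. x \<in> carrier H \<Longrightarrow> y \<in> carrier H \<Longrightarrow> f (x \<otimes>\<^bsub>H\<^esub> y) = f x \<otimes>\<^bsub>G\<^esub> f y"
    and inj: "inj_on f (carrier H)" and surj: "f ` carrier H = carrier G"
    using f by (auto simp: iso_def hom_def bij_betw_def)
  have AB: "A \<subseteq> carrier H" "B \<subseteq> carrier H"
    using fac by (auto simp: group_factorization_def)
  show "card (f ` A) = card A" "card (f ` B) = card B"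
    using AB inj by (auto intro: card_image inj_on_subset)
  have uniq: "\<exists>!p. p \<in> f ` A \<times> f ` B \<and> g = fst p \<otimes>\<^bsub>G\<^esub> snd p" if "g \<in> carrier G" for g
  proof -
    have "g \<in> f ` carrier H" using that by (simp add: surj)
    then obtain h where h: "h \<in> carrier H" "g = f h" by (elim imageE)
    have "\<exists>!p. p \<in> A \<times> B \<and> h = fst p \<otimes>\<^bsub>H\<^esub> snd p"
      using fac h(1) by (simp add: group_factorization_def)
    then obtain p where p: "p \<in> A \<times> B" "h = fst p \<otimes>\<^bsub>H\<^esub> snd p"
      and pu: "\<And>q. q \<in> A \<times> B \<Longrightarrow> h = fst q \<otimes>\<^bsub>H\<^esub> snd q \<Longrightarrow> q = p"
      by (elim ex1E) blast
    obtain u v where uv: "p = (u, v)" by (cases p)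
    have c: "u \<in> carrier H" "v \<in> carrier H" using p(1) uv AB by auto
    show ?thesis
    proof (rule ex1I[of _ "map_prod f f p"])
      show "map_prod f f p \<in> f ` A \<times> f ` B \<and>
            g = fst (map_prod f f p) \<otimes>\<^bsub>G\<^esub> snd (map_prod f f p)"
        using p uv h hom[OF c] by simp
    next
      fix q assume q: "q \<in> f ` A \<times> f ` B \<and> g = fst q \<otimes>\<^bsub>G\<^esub> snd q"
      then obtain x y where xy: "x \<in> A" "y \<in> B" "q = (f x, f y)" by auto
      then have c: "x \<in> carrier H" "y \<in> carrier H" using AB by auto
      have "f (x \<otimes>\<^bsub>H\<^esub> y) = f h" using q xy c hom h by auto
      moreover have "x \<otimes>\<^bsub>H\<^esub> y \<in> carrier H"
        using grp c by (simp add: group.is_monoid monoid.m_closed)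
      ultimately have "x \<otimes>\<^bsub>H\<^esub> y = h" using inj h by (meson inj_onD)
      then show "q = map_prod f f p" using pu[of "(x, y)"] xy by auto
    qed
  qed
  then show "group_factorization G (f ` A) (f ` B)"
    using image_mono[OF AB(1), of f] image_mono[OF AB(2), of f] surj
    by (simp add: group_factorization_def)
qed

lemma class_F_if_nat_groups:
  assumes min: "smaller_groups_in_F n"
    and G: "group G" "finite (carrier G)" "order G < n"
  shows "class_F G"
proof -
  obtain e :: "_ \<Rightarrow> nat" where e: "inj_on e (carrier G)"
    using finite_imp_inj_to_nat_seg[OF G(2)] by blast
  define d where "d = inv_into (carrier G) e"
  define H :: "nat monoid" where
    "H = \<lparr>carrier = e ` carrier G, monoid.mult = (\<lambda>x y. e (d x \<otimes>\<^bsub>G\<^esub> d y)), one = e \<one>\<^bsub>G\<^esub>\<rparr>"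
  have de: "\<And>x. x \<in> carrier G \<Longrightarrow> d (e x) = x"
    unfolding d_def using e by simp
  interpret G: group G by fact
  have grpH: "group H"
  proof (rule groupI)
    fix x assume "x \<in> carrier H"
    then obtain g where g: "g \<in> carrier G" "x = e g" by (auto simp: H_def)
    then show "\<exists>y \<in> carrier H. y \<otimes>\<^bsub>H\<^esub> x = \<one>\<^bsub>H\<^esub>"
      by (intro bexI[of _ "e (inv\<^bsub>G\<^esub> g)"]) (auto simp: H_def de)
  qed (auto simp: H_def de G.m_assoc)
  have d: "d \<in> iso H G"
    using e by (auto simp: iso_def hom_def bij_betw_def H_def de inj_on_def image_image)
  have ord: "order H = order G" using e by (simp add: order_def H_def card_image)
  have "class_F H"
    using min grpH G ord unfolding smaller_groups_in_F_def by (simp add: H_def)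
  then have fac: "\<exists>A B. group_factorization H A B \<and> card A = a \<and> card B = b"
    if "a > 0" "b > 0" "order G = a * b" for a b
    using that ord by (simp add: class_F_def)
  have "\<exists>A B. group_factorization G A B \<and> card A = a \<and> card B = b"
    if ab: "a > 0" "b > 0" "order G = a * b" for a b
  proof -
    obtain A B where AB: "group_factorization H A B" "card A = a" "card B = b"
      using fac[OF ab] by blast
    show ?thesis
      using group_factorization_iso[OF grpH d AB(1)] AB(2,3) by blast
  qed
  then show ?thesis
    using G(1,2) by (simp add: class_F_def)
qed

end

theory Submission
  imports Defs
begin

text \<open>
  Factorizations lift along subgroups and extensions. If \<open>H = AB\<close> is a proper subgroup, then
  \<open>G = A(BT)\<close> for a right transversal \<open>T\<close> of \<open>H\<close>, and \<open>G = (SA)B\<close> for a left transversal \<open>S\<close>;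
  this gives (ii). If \<open>N\<close> is normal, \<open>N = AB\<close>, and \<open>U\<close>, \<open>V\<close> are lifts of the factors of \<open>G/N\<close>,
  then \<open>G = UNV = (UA)(BV)\<close>; since \<open>ab = |N||G/N|\<close> splits into divisors of \<open>|N|\<close> and \<open>|G/N|\<close>,
  membership in \<open>\<F>\<close> passes to extensions, so a minimal counterexample is simple. It is not
  abelian, since \<open>a \<in> \<D>(G)\<close> has a prime divisor \<open>p < |G|\<close> and \<open>G\<close> has a subgroup of order \<open>p\<close>.

  As \<open>|AB| \<le> |A||B|\<close>, uniqueness of the representations and the sizes of the factors follow
  by counting once the products are known to cover \<open>G\<close>.
\<close>

section \<open>Product sets and the counting criterion\<close>

lemma set_mult_eq_image: "A <#>\<^bsub>G\<^esub> B = (\<lambda>(x, y). x \<otimes>\<^bsub>G\<^esub> y) ` (A \<times> B)"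
  by (auto simp: set_mult_def)

lemma card_set_mult_le:
  assumes "finite A" "finite B"
  shows "card (A <#>\<^bsub>G\<^esub> B) \<le> card A * card B"
  using card_image_le[of "A \<times> B"] assms
  by (simp add: set_mult_eq_image card_cartesian_product)

lemma group_factorization_set_mult:
  assumes "group_factorization G A B" "g \<in> carrier G"
  shows "g \<in> A <#>\<^bsub>G\<^esub> B"
proof -
  obtain p where "p \<in> A \<times> B" "g = fst p \<otimes>\<^bsub>G\<^esub> snd p"
    using assms unfolding group_factorization_def by blast
  then show ?thesis
    unfolding set_mult_eq_image by (intro image_eqI[of _ _ p]) (auto simp: case_prod_beta)
qed

text \<open>The chain |G| \<le> |AB| \<le> |A||B| \<le> ab = |G| collapses to equalities.
  Multiplication on \<open>A \<times> B\<close> is then injective, and a strict bound on either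
  factor would make the product too small. Later proofs thus need only a cover and upper
  bounds.\<close>

lemma group_factorization_if_cover:
  assumes fin: "finite (carrier G)" "carrier G \<noteq> {}"
    and AB: "A \<subseteq> carrier G" "B \<subseteq> carrier G"
    and cover: "carrier G \<subseteq> A <#>\<^bsub>G\<^esub> B"
    and le: "card A \<le> a" "card B \<le> b" and ab: "order G = a * b"
  shows "group_factorization G A B \<and> card A = a \<and> card B = b"
proof -
  let ?f = "\<lambda>(x, y). x \<otimes>\<^bsub>G\<^esub> y"
  have finAB: "finite A" "finite B" using AB fin(1) finite_subset by auto
  have "order G > 0" using fin by (simp add: order_def card_gt_0_iff)
  then have pos: "a > 0" "b > 0" using ab by auto
  have 1: "order G \<le> card (A <#>\<^bsub>G\<^esub> B)"
    unfolding order_def using cover finAB by (intro card_mono) (auto simp: set_mult_eq_image)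
  have 2: "card (A <#>\<^bsub>G\<^esub> B) \<le> card A * card B" by (rule card_set_mult_le[OF finAB])
  have 3: "card A * card B \<le> a * b" using le by (rule mult_le_mono)
  have eq: "card A * card B = a * b" "card (?f ` (A \<times> B)) = card (A \<times> B)"
    using 1 2 3 ab by (simp_all add: set_mult_eq_image card_cartesian_product)
  have cA: "card A = a"
  proof (rule ccontr)
    assume "card A \<noteq> a"
    then have "card A < a" using le by simp
    then have "card A * card B < a * b"
      using le pos by (meson le_less_trans mult_le_mono2 mult_less_mono1)
    then show False using eq by simp
  qed
  then have cB: "card B = b" using eq pos by simp
  have inj: "inj_on ?f (A \<times> B)" using eq(2) finAB by (intro eq_card_imp_inj_on) auto
  have "\<exists>!p. p \<in> A \<times> B \<and> g = fst p \<otimes>\<^bsub>G\<^esub> snd p" if "g \<in> carrier G" for g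
  proof -
    have "g \<in> ?f ` (A \<times> B)" using cover that by (auto simp: set_mult_eq_image)
    then obtain p where "p \<in> A \<times> B" "g = ?f p" by auto
    then show ?thesis using inj by (intro ex1I[of _ p]) (auto simp: inj_on_def)
  qed
  then show ?thesis using AB cA cB by (auto simp: group_factorization_def)
qed

section \<open>Transversals and factorizations induced by a subgroup\<close>

context group
begin

text \<open>One representative is chosen from each right coset, and Lagrange bounds their number. An
  inequality suffices for the counting criterion.\<close>

lemma right_transversal_exists:
  assumes H: "subgroup H G" and fin: "finite (carrier G)"
  obtains T where "T \<subseteq> carrier G" "carrier G \<subseteq> H <#> T" "card T * card H \<le> order G"
proof
  interpret H: subgroup H G by fact
  define s :: "'a set \<Rightarrow> 'a" where "s C = (SOME x. x \<in> C)" for C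
  have s: "s C \<in> C" if "C \<in> rcosets H" for C
    unfolding s_def using H.rcosets_non_empty[OF that] by (simp add: some_in_eq)
  let ?T = "s ` (rcosets H)"
  show T: "?T \<subseteq> carrier G"
    using s H.rcosets_carrier[OF is_group] by blast
  have finR: "finite (rcosets H)"
    using fin by (simp add: RCOSETS_def)
  then have "card ?T * card H \<le> card (rcosets H) * card H"
    by (intro mult_le_mono card_image_le) auto
  then show "card ?T * card H \<le> order G" using lagrange[OF H] by simp
  show "carrier G \<subseteq> H <#> ?T"
  proof
    fix g assume g: "g \<in> carrier G"
    then have C: "H #> g \<in> rcosets H" by (auto simp: RCOSETS_def)
    then obtain h where h: "h \<in> H" "s (H #> g) = h \<otimes> g"
      using s[OF C] by (auto simp: r_coset_def)
    then have "g = inv h \<otimes> s (H #> g)" using g by (simp add: m_assoc[symmetric])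
    then show "g \<in> H <#> ?T" using C h(1) unfolding set_mult_def by blast
  qed
qed

text \<open>Since \<open>H\<close> is closed under inverses, inverting a right transversal gives a
  left one.\<close>

lemma left_transversal_exists:
  assumes H: "subgroup H G" and fin: "finite (carrier G)"
  obtains S where "S \<subseteq> carrier G" "carrier G \<subseteq> S <#> H" "card S * card H \<le> order G"
proof -
  interpret H: subgroup H G by fact
  obtain T where T: "T \<subseteq> carrier G" "carrier G \<subseteq> H <#> T" "card T * card H \<le> order G"
    using right_transversal_exists[OF assms] .
  let ?S = "(\<lambda>x. inv x) ` T"
  have "card ?S \<le> card T" using T(1) fin by (intro card_image_le) (rule finite_subset)
  then have "card ?S * card H \<le> order G" using T(3) by (meson le_trans mult_le_mono1)
  moreover have "carrier G \<subseteq> ?S <#> H"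
  proof
    fix g assume g: "g \<in> carrier G"
    then have "inv g \<in> H <#> T" using T(2) by auto
    then obtain h t where ht: "h \<in> H" "t \<in> T" "inv g = h \<otimes> t" by (auto simp: set_mult_def)
    then have "g = inv (h \<otimes> t)" using g by (metis inv_inv)
    then have "g = inv t \<otimes> inv h" using ht T(1) by (auto simp: inv_mult_group)
    then show "g \<in> ?S <#> H" using ht unfolding set_mult_def by blast
  qed
  ultimately show ?thesis using T(1) by (intro that[of ?S]) auto
qed

text \<open>Uniqueness is dropped on purpose: covers compose by associativity and monotonicity of
  \<open><#>\<close>, and counting restores uniqueness at the end.\<close>

lemma subgroup_set_mult_decomp:
  assumes F: "class_F (G\<lparr>carrier := H\<rparr>)" and ab: "a * b = card H" "card H > 0"
  obtains A B where "A \<subseteq> H" "B \<subseteq> H" "H \<subseteq> A <#> B" "card A = a" "card B = b"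
proof -
  have "a > 0" "b > 0" using ab by (auto intro: Nat.gr0I)
  moreover have "order (G\<lparr>carrier := H\<rparr>) = a * b" using ab by (simp add: order_def)
  ultimately obtain A B where AB: "group_factorization (G\<lparr>carrier := H\<rparr>) A B" "card A = a" "card B = b"
    using F unfolding class_F_def by blast
  have "A \<subseteq> H" "B \<subseteq> H" using AB(1) by (auto simp: group_factorization_def)
  moreover have "H \<subseteq> A <#> B"
    using group_factorization_set_mult[OF AB(1)] by (auto simp: set_mult_def)
  ultimately show ?thesis using that AB by blast
qed

lemma set_mult_finite_closed:
  assumes "finite (carrier G)" "A \<subseteq> carrier G" "B \<subseteq> carrier G"
  shows "finite A" "finite B" "A <#> B \<subseteq> carrier G"
  using assms finite_subset by (auto simp: set_mult_def)

text \<open>The transversal is absorbed into the second factor, G = HT = A(BT), so \<open>A\<close>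
  keeps its size \<open>a\<close>.\<close>

lemma factorization_if_subgroup_left:
  assumes fin: "finite (carrier G)" and H: "subgroup H G"
    and F: "class_F (G\<lparr>carrier := H\<rparr>)"
    and a: "a dvd card H" and ab: "order G = a * b"
  shows "\<exists>A B. group_factorization G A B \<and> card A = a \<and> card B = b"
proof -
  have Hc: "H \<subseteq> carrier G" "card H > 0"
    using subgroup.subset[OF H] subgroup.finite_imp_card_positive[OF H fin] by auto
  obtain c where c: "a * c = card H" using a by (metis dvd_def)
  obtain A B where AB: "A \<subseteq> H" "B \<subseteq> H" "H \<subseteq> A <#> B" "card A = a" "card B = c"
    using subgroup_set_mult_decomp[OF F c Hc(2)] .
  obtain T where T: "T \<subseteq> carrier G" "carrier G \<subseteq> H <#> T" "card T * card H \<le> order G"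
    using right_transversal_exists[OF H fin] .
  have AB': "A \<subseteq> carrier G" "B \<subseteq> carrier G" using AB(1,2) Hc(1) by blast+
  note fT = set_mult_finite_closed[OF fin AB'(2) T(1)]
  \<comment> \<open>This is |H||T| \<le> |G| rewritten; cancelling \<open>a\<close> bounds the size
    of BT by \<open>b\<close>.\<close>
  have "a * (c * card T) \<le> a * b"
    using T(3) unfolding ab c[symmetric] by (simp only: ac_simps)
  moreover have "a > 0" using c Hc by (auto intro: Nat.gr0I)
  ultimately have "card (B <#> T) \<le> b"
    using card_set_mult_le[OF fT(1,2), of G] AB(5) by simp
  moreover have "carrier G \<subseteq> A <#> (B <#> T)"
    using T(2) mono_set_mult[OF AB(3) order_refl, of G T] set_mult_assoc[OF AB' T(1)] by auto
  ultimately have "group_factorization G A (B <#> T) \<and> card A = a \<and> card (B <#> T) = b"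
    using fin AB' AB(4) fT ab by (intro group_factorization_if_cover) auto
  then show ?thesis by blast
qed

text \<open>Mirror image: G = SH = (SA)B leaves the second factor inside \<open>H\<close>.\<close>

lemma factorization_if_subgroup_right:
  assumes fin: "finite (carrier G)" and H: "subgroup H G"
    and F: "class_F (G\<lparr>carrier := H\<rparr>)"
    and b: "b dvd card H" and ab: "order G = a * b"
  shows "\<exists>A B. group_factorization G A B \<and> card A = a \<and> card B = b"
proof -
  have Hc: "H \<subseteq> carrier G" "card H > 0"
    using subgroup.subset[OF H] subgroup.finite_imp_card_positive[OF H fin] by auto
  obtain c where c: "c * b = card H" using b by (metis dvd_def mult.commute)
  obtain A B where AB: "A \<subseteq> H" "B \<subseteq> H" "H \<subseteq> A <#> B" "card A = c" "card B = b"
    using subgroup_set_mult_decomp[OF F c Hc(2)] .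
  obtain S where S: "S \<subseteq> carrier G" "carrier G \<subseteq> S <#> H" "card S * card H \<le> order G"
    using left_transversal_exists[OF H fin] .
  have AB': "A \<subseteq> carrier G" "B \<subseteq> carrier G" using AB(1,2) Hc(1) by blast+
  note fS = set_mult_finite_closed[OF fin S(1) AB'(1)]
  have "(card S * c) * b \<le> a * b"
    using S(3) unfolding ab c[symmetric] by (simp only: ac_simps)
  moreover have "b > 0" using c Hc by (auto intro: Nat.gr0I)
  ultimately have "card (S <#> A) \<le> a"
    using card_set_mult_le[OF fS(1,2), of G] AB(4) by simp
  moreover have "carrier G \<subseteq> (S <#> A) <#> B"
    using S(2) mono_set_mult[OF order_refl AB(3), of G S] set_mult_assoc[OF S(1) AB'] by auto
  ultimately have "group_factorization G (S <#> A) B \<and> card (S <#> A) = a \<and> card B = b"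
    using fin AB' AB(5) fS ab by (intro group_factorization_if_cover) auto
  then show ?thesis by blast
qed

end

section \<open>Quotients and extensions\<close>

text \<open>\<open>U\<close> and \<open>V\<close> consist of chosen coset representatives. Keeping
  \<open>H\<close> in the middle lets it be split later between the left and the right
  factor.\<close>

lemma (in normal) quotient_set_mult_lift:
  assumes fac: "group_factorization (G Mod H) P Q"
  obtains U V where "U \<subseteq> carrier G" "V \<subseteq> carrier G" "carrier G \<subseteq> (U <#> H) <#> V"
    "finite P \<longrightarrow> card U \<le> card P" "finite Q \<longrightarrow> card V \<le> card Q"
proof -
  define s :: "'a set \<Rightarrow> 'a" where "s C = (SOME x. x \<in> C)" for C
  have s: "s C \<in> carrier G" "C = H #> s C" if C: "C \<in> rcosets H" for C
  proof -
    have sC: "s C \<in> C"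
      unfolding s_def using rcosets_non_empty[OF C] by (simp add: some_in_eq)
    then show "s C \<in> carrier G" using C rcosets_carrier[OF is_group] by blast
    obtain x where "x \<in> carrier G" "C = H #> x" using C by (auto simp: RCOSETS_def)
    then show "C = H #> s C" using sC repr_independence[OF _ _ is_subgroup] by simp
  qed
  have PQ: "P \<subseteq> rcosets H" "Q \<subseteq> rcosets H"
    using fac by (auto simp: group_factorization_def FactGroup_def)
  have "carrier G \<subseteq> (s ` P <#> H) <#> s ` Q"
  proof
    fix g assume g: "g \<in> carrier G"
    then have "H #> g \<in> carrier (G Mod H)" by (auto simp: FactGroup_def RCOSETS_def)
    from group_factorization_set_mult[OF fac this]
    obtain C D where CD: "C \<in> P" "D \<in> Q" "H #> g = C <#> D"
      unfolding set_mult_eq_image[where G = "G Mod H"] by (auto simp: FactGroup_def)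
    let ?x = "s C" and ?y = "s D"
    have xy: "?x \<in> carrier G" "?y \<in> carrier G" "C = H #> ?x" "D = H #> ?y"
      using s CD PQ by auto
    then have "H #> g = H #> (?x \<otimes> ?y)" using CD(3) rcos_sum by metis
    then have "g \<in> H #> (?x \<otimes> ?y)" using rcos_self[OF g is_subgroup] by simp
    then obtain n where n: "n \<in> H" "g = n \<otimes> (?x \<otimes> ?y)" by (auto simp: r_coset_def)
    \<comment> \<open>Normality moves \<open>n\<close> to the right past \<open>?x\<close>,
      replacing it by a conjugate that is still in \<open>H\<close>.\<close>
    have "g = (?x \<otimes> (inv ?x \<otimes> n \<otimes> ?x)) \<otimes> ?y"
      using n xy(1,2) by (simp add: m_assoc[symmetric])
    moreover have "inv ?x \<otimes> n \<otimes> ?x \<in> H" using inv_op_closed1[OF xy(1) n(1)] .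
    ultimately show "g \<in> (s ` P <#> H) <#> s ` Q"
      using CD unfolding set_mult_def by blast
  qed
  moreover have "s ` P \<subseteq> carrier G" "s ` Q \<subseteq> carrier G" using s PQ by auto
  ultimately show ?thesis by (intro that[of "s ` P" "s ` Q"]) (auto intro: card_image_le)
qed

lemma split_factorization:
  fixes a b m k :: nat
  assumes "a * b = m * k" "a > 0"
  obtains a1 a2 b1 b2 where "a = a1 * a2" "b = b1 * b2" "a1 * b1 = m" "a2 * b2 = k"
proof -
  have "a dvd m * k" using assms(1) by (metis dvd_triv_left)
  then obtain a1 a2 where aa: "a = a1 * a2" "a1 dvd m" "a2 dvd k"
    using division_decomp by blast
  then obtain b1 b2 where bb: "m = a1 * b1" "k = a2 * b2" by (auto elim!: dvdE)
  have "(a1 * a2) * b = (a1 * a2) * (b1 * b2)" using assms(1) aa(1) bb by (simp add: ac_simps)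
  then have "b = b1 * b2" using assms(2) aa(1) by simp
  then show ?thesis using that aa bb by blast
qed

text \<open>With N = AB and lifts \<open>U\<close>, \<open>V\<close> of the factors of the quotient,
  G = UNV = (UA)(BV). The sizes a1, a2, b1, b2 from \<open>split_factorization\<close> make the two
  factors have orders \<open>a\<close> and \<open>b\<close>.\<close>

lemma class_F_extension:
  assumes N: "N \<lhd> G" and fin: "finite (carrier G)"
    and FN: "class_F (G\<lparr>carrier := N\<rparr>)" and FQ: "class_F (G Mod N)"
  shows "class_F G"
proof -
  interpret normal N G by fact
  have Npos: "card N > 0" using fin finite_imp_card_positive by simp
  have ord: "card N * order (G Mod N) = order G"
    using lagrange[OF is_subgroup] by (simp add: order_def FactGroup_def mult.commute)
  have "\<exists>A B. group_factorization G A B \<and> card A = a \<and> card B = b"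
    if ab: "a > 0" "b > 0" "order G = a * b" for a b
  proof -
    obtain a1 a2 b1 b2 where d: "a = a1 * a2" "b = b1 * b2" "a1 * b1 = card N"
      "a2 * b2 = order (G Mod N)"
      using split_factorization[of a b "card N" "order (G Mod N)"] ord ab by metis
    obtain A B where AB: "A \<subseteq> N" "B \<subseteq> N" "N \<subseteq> A <#>\<^bsub>G\<^esub> B" "card A = a1" "card B = b1"
      using subgroup_set_mult_decomp[OF FN d(3) Npos] .
    have "a2 > 0" "b2 > 0" using ab d by auto
    then obtain P Q where PQ: "group_factorization (G Mod N) P Q" "card P = a2" "card Q = b2"
      using FQ d(4) unfolding class_F_def by metis
    \<comment> \<open>Infinite sets have \<open>card\<close> 0, so positive cardinality gives
      finiteness.\<close>
    have "finite P" "finite Q" using PQ \<open>a2 > 0\<close> \<open>b2 > 0\<close> by (auto intro: card_ge_0_finite)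
    then obtain U V where UV: "U \<subseteq> carrier G" "V \<subseteq> carrier G"
      "carrier G \<subseteq> (U <#>\<^bsub>G\<^esub> N) <#>\<^bsub>G\<^esub> V" "card U \<le> a2" "card V \<le> b2"
      using quotient_set_mult_lift[OF PQ(1)] PQ(2,3) by metis
    have AB': "A \<subseteq> carrier G" "B \<subseteq> carrier G" using AB(1,2) subset by blast+
    note fU = set_mult_finite_closed[OF fin UV(1) AB'(1)] and fV = set_mult_finite_closed[OF fin AB'(2) UV(2)]
    have "card (U <#>\<^bsub>G\<^esub> A) \<le> a"
      using le_trans[OF card_set_mult_le[OF fU(1,2), of G] mult_le_mono1[OF UV(4)]] AB(4) d(1)
      by (simp add: mult.commute)
    moreover have "card (B <#>\<^bsub>G\<^esub> V) \<le> b"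
      using le_trans[OF card_set_mult_le[OF fV(1,2), of G] mult_le_mono2[OF UV(5)]] AB(5) d(2)
      by simp
    moreover have "carrier G \<subseteq> (U <#>\<^bsub>G\<^esub> A) <#>\<^bsub>G\<^esub> (B <#>\<^bsub>G\<^esub> V)"
    proof -
      have "(U <#>\<^bsub>G\<^esub> N) <#>\<^bsub>G\<^esub> V \<subseteq> (U <#>\<^bsub>G\<^esub> (A <#>\<^bsub>G\<^esub> B)) <#>\<^bsub>G\<^esub> V"
        using AB(3) by (intro mono_set_mult) auto
      also have "\<dots> = (U <#>\<^bsub>G\<^esub> A) <#>\<^bsub>G\<^esub> (B <#>\<^bsub>G\<^esub> V)"
        using UV AB' by (simp add: set_mult_assoc set_mult_closed)
      finally show ?thesis using UV(3) by auto
    qed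
    ultimately have "group_factorization G (U <#>\<^bsub>G\<^esub> A) (B <#>\<^bsub>G\<^esub> V)
        \<and> card (U <#>\<^bsub>G\<^esub> A) = a \<and> card (B <#>\<^bsub>G\<^esub> V) = b"
      using fin fU fV ab by (intro group_factorization_if_cover) auto
    then show ?thesis by blast
  qed
  then show ?thesis using fin is_group by (simp add: class_F_def)
qed

section \<open>Structure of a minimal counterexample\<close>

lemma minimal_non_F_subgroup:
  assumes "minimal_non_F G" "subgroup H G" "H \<noteq> carrier G"
  shows "class_F (G\<lparr>carrier := H\<rparr>)"
proof (rule class_F_if_nat_groups)
  show "smaller_groups_in_F (order G)" using assms(1) by (simp add: minimal_non_F_def)
  have G: "group G" "finite (carrier G)" using assms(1) by (auto simp: minimal_non_F_def)
  have H: "H \<subset> carrier G" using assms subgroup.subset by blast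
  show "group (G\<lparr>carrier := H\<rparr>)" using subgroup.subgroup_is_group[OF assms(2) G(1)] .
  show "finite (carrier (G\<lparr>carrier := H\<rparr>))" using H G finite_subset by auto
  show "order (G\<lparr>carrier := H\<rparr>) < order G"
    using psubset_card_mono[OF G(2) H] by (simp add: order_def)
qed

theorem proposition1:
  fixes G :: "('a, 'b) monoid_scheme"
  assumes "minimal_non_F G"
  shows "(simple_group G \<and> \<not> comm_group G) \<and>
    (\<forall>a \<in> set_D G. \<forall>H. subgroup H G \<longrightarrow> H \<noteq> carrier G \<longrightarrow>
        \<not> a dvd card H \<and> \<not> (order G div a) dvd card H)"
proof -
  have grp: "group G" and fin: "finite (carrier G)" and nF: "\<not> class_F G"
    and small: "smaller_groups_in_F (order G)"
    using assms by (auto simp: minimal_non_F_def)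
  interpret group G by fact
  have ii: "\<not> a dvd card H \<and> \<not> (order G div a) dvd card H"
    if a: "a \<in> set_D G" and H: "subgroup H G" "H \<noteq> carrier G" for a H
  proof -
    have ab: "order G = a * (order G div a)" using a by (simp add: set_D_def)
    have "\<not> (\<exists>A B. group_factorization G A B \<and> card A = a \<and> card B = order G div a)"
      using a by (simp add: set_D_def)
    then show ?thesis
      using factorization_if_subgroup_left[OF fin H(1) _ _ ab]
        factorization_if_subgroup_right[OF fin H(1) _ _ ab]
        minimal_non_F_subgroup[OF assms H] by blast
  qed
  obtain a where a: "a \<in> set_D G"
    using nF class_F_iff_set_D_empty[OF grp fin] by auto
  then have a': "a > 0" "a dvd order G" by (auto simp: set_D_def)
  have opos: "order G > 0" using fin order_gt_0_iff_finite by simp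
  \<comment> \<open>The trivial group factors as the product of two singletons, so it cannot be a
    counterexample.\<close>
  have "order G \<noteq> 1"
  proof
    assume 1: "order G = 1"
    then have "carrier G = {\<one>\<^bsub>G\<^esub>}"
      using one_closed unfolding order_def by (metis card_1_singletonE singletonD)
    with 1 have "group_factorization G {\<one>\<^bsub>G\<^esub>} {\<one>\<^bsub>G\<^esub>} \<and> card {\<one>\<^bsub>G\<^esub>} = a \<and> card {\<one>\<^bsub>G\<^esub>} = order G div a"
      using a' by (intro group_factorization_if_cover)
        (auto simp: fin set_mult_def)
    then show False using a unfolding set_D_def by blast
  qed
  then have o1: "order G > 1" using opos by simp
  have triv: "{\<one>\<^bsub>G\<^esub>} \<noteq> carrier G"
  proof
    assume "{\<one>\<^bsub>G\<^esub>} = carrier G"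
    then have "order G = card {\<one>\<^bsub>G\<^esub>}" by (simp add: order_def)
    then show False using o1 by simp
  qed
  have simple: "N = carrier G \<or> N = {\<one>\<^bsub>G\<^esub>}" if N: "N \<lhd> G" for N
  proof (rule ccontr)
    assume c: "\<not> ?thesis"
    interpret N: normal N G by fact
    have sub: "subgroup N G" by (rule N.is_subgroup)
    have "card N > 0" using fin N.finite_imp_card_positive by simp
    moreover have "card N \<noteq> 1"
      using c N.one_closed by (metis card_1_singletonE singletonD)
    ultimately have N1: "card N > 1" by simp
    have lag: "order (G Mod N) * card N = order G"
      using lagrange[OF sub] by (simp add: order_def FactGroup_def)
    then have "order (G Mod N) > 0" using opos by (metis mult_0 neq0_conv)
    then have "order (G Mod N) < order G"
      using n_less_n_mult_m[of "order (G Mod N)" "card N"] lag N1 by simp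
    moreover have "finite (carrier (G Mod N))" using fin by (simp add: FactGroup_def RCOSETS_def)
    \<comment> \<open>The quotient lives on a type of cosets, so minimality over \<open>nat\<close>
      has to be transferred.\<close>
    ultimately have "class_F (G Mod N)"
      using class_F_if_nat_groups[OF small N.factorgroup_is_group] by blast
    then show False
      using class_F_extension[OF N fin] minimal_non_F_subgroup[OF assms sub] c nF by blast
  qed
  then have "simple_group G"
    using grp o1 by (simp add: simple_group_def simple_group_axioms_def)
  moreover have "\<not> comm_group G"
  proof
    assume "comm_group G"
    then interpret comm_group G .
    \<comment> \<open>1 divides the order of the trivial subgroup, which is proper, contradicting
      (ii).\<close>
    have "a \<noteq> 1" using ii[OF a triv_subgroup triv] by auto
    then obtain p where p: "Factorial_Ring.prime p" "p dvd a" using prime_factor_nat by blast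
    \<comment> \<open>Exponent 1 turns Sylow's theorem into Cauchy's; \<open>m\<close> may still be
      divisible by \<open>p\<close>.\<close>
    obtain m where m: "order G = p ^ 1 * m"
      using a' p(2) by (metis dvd_def dvd_trans power_one_right)
    obtain P where P: "subgroup P G" "card P = p"
      using sylow_thm[OF p(1) grp m fin] by auto
    have "P \<lhd> G" using P(1) subgroup_imp_normal by blast
    then have "P = carrier G \<or> P = {\<one>\<^bsub>G\<^esub>}" by (rule simple)
    moreover have "P \<noteq> {\<one>\<^bsub>G\<^esub>}" using P(2) p(1) by auto
    \<comment> \<open>In the remaining case \<open>G\<close> has prime order, which forces
      \<open>a = order G\<close>. The cofactor is then 1, and (ii) for the trivial subgroup fails
      again.\<close>
    ultimately have pn: "p = order G" using P(2) by (simp add: order_def)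
    then have "a = order G" using p(2) a' by (simp add: dvd_antisym)
    then have "order G div a = 1" using opos by simp
    then show False using ii[OF a triv_subgroup triv] by simp
  qed
  ultimately show ?thesis using ii by blast
qed

end
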